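(* Let $n\ge 2$ and let $P\subset\mathbb{R}^n$ be a compact convex polytope with non-empty interior. Then: (1) $\mathcal{N}(P)\ge 2n+2$; that is, there is a point $y\in \mathrm{Int}\,P$ from which at least $2n+2$ normals to $\partial P$ emanate. (2) $\mathcal{N}(P)$ does not exceed the number of faces of $P$.
   Context: A face of $P$ is the intersection of $P$ with a support hyperplane; faces have dimensions $0,1,\dots,n-1$ ($P$ itself is not counted). For $y\in \mathrm{Int}\,P$, a normal to $\partial P$ emanating from $y$ is a segment $yz$ such that there is a support hyperplane $h$ of $P$ with $z\in h\cap P$ and $yz$ orthogonal to $h$; $z$ is the base of the normal. $n(P,y)$ is the number of normals to $\partial P$ emanating from $y$ (equivalently, the number of their bases), and $\mathcal{N}(P)=\max_{y\in \mathrm{Int}\,P} n(P,y)$. *)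

theory Defs
  imports "HOL-Analysis.Analysis"
begin

definition support_hyperplane :: "'a::euclidean_space set \<Rightarrow> 'a set \<Rightarrow> bool" where
  "support_hyperplane P h \<longleftrightarrow>
     (\<exists>a b. a \<noteq> 0 \<and> h = {x. a \<bullet> x = b} \<and> P \<subseteq> {x. a \<bullet> x \<le> b} \<and> h \<inter> P \<noteq> {})"

(* Unlike face_of, this never counts the empty set, nor P itself when P has interior points. *)
definition support_faces :: "'a::euclidean_space set \<Rightarrow> 'a set set" where
  "support_faces P = {P \<inter> h |h. support_hyperplane P h}"

definition segment_orthogonal :: "'a::euclidean_space \<Rightarrow> 'a \<Rightarrow> 'a set \<Rightarrow> bool" where
  "segment_orthogonal y z h \<longleftrightarrow> (\<forall>u\<in>h. \<forall>v\<in>h. orthogonal (z - y) (u - v))"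

definition normals :: "'a::euclidean_space set \<Rightarrow> 'a \<Rightarrow> 'a set set" where
  "normals P y =
     {closed_segment y z |z. \<exists>h. support_hyperplane P h \<and> z \<in> h \<inter> P \<and> segment_orthogonal y z h}"

definition num_normals :: "'a::euclidean_space set \<Rightarrow> 'a \<Rightarrow> nat" where
  "num_normals P y = card (normals P y)"

(* Meaningful only if all normals P y are finite and num_normals P is bounded on the interior. *)
definition max_num_normals :: "'a::euclidean_space set \<Rightarrow> nat" where
  "max_num_normals P = Max (num_normals P ` interior P)"

end

theory Submission
  imports Defs
begin

text \<open>A base of a normal from \<open>y\<close> determines the face in which its supporting hyperplane
  meets \<open>P\<close>, and is determined by it; hence the upper bound.

  For the lower bound, take \<open>y\<close> to be an extreme point of the set of centres of maximal inscribed
  balls. Such a ball touches at least \<open>n + 1\<close> facets, and the touching points are \<open>n + 1\<close> minima of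
  the distance from \<open>y\<close> on the boundary of \<open>P\<close>. As in Morse theory, connecting these minima inside
  sublevel sets costs at least \<open>n\<close> further bases, which are saddles. The connections are followed in
  the incidence graph of the facets, so that no genericity of \<open>y\<close> is needed. The boundary remains
  connected after removing a farthest point \<open>zs\<close>, so \<open>zs\<close> is not one of the required saddles and
  is the last base.\<close>

section \<open>Bases of normals and the upper bound\<close>

text \<open>For interior \<open>y\<close>, only the hyperplane with normal vector
  \<open>z - y\<close> can witness a normal with base \<open>z\<close>, so the condition is that
  \<open>z - y\<close> lies in the normal cone of \<open>P\<close> at \<open>z\<close>.\<close>

definition bases :: "'a::euclidean_space set \<Rightarrow> 'a \<Rightarrow> 'a set" where
  "bases P y = {z \<in> P. z \<noteq> y \<and> (\<forall>x\<in>P. (z - y) \<bullet> (x - z) \<le> 0)}"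

lemma inner_less_of_interior:
  fixes a :: "'a::euclidean_space"
  assumes "y \<in> interior P" "a \<noteq> 0" "P \<subseteq> {x. a \<bullet> x \<le> b}"
  shows "a \<bullet> y < b"
  using interior_mono[OF assms(3)] assms(1,2) by (auto simp: interior_halfspace_le)

text \<open>An outer normal of a supporting hyperplane orthogonal to \<open>yz\<close> is parallel
  to \<open>z - y\<close>, and points the same way because \<open>y\<close> lies strictly on the
  inner side.\<close>

lemma normals_eq_image_bases:
  assumes y: "y \<in> interior P"
  shows "normals P y = closed_segment y ` bases P y"
proof (intro subset_antisym subsetI)
  fix s assume "s \<in> normals P y"
  then obtain z h where s: "s = closed_segment y z" and h: "support_hyperplane P h" "z \<in> h \<inter> P"
    and orth: "segment_orthogonal y z h"
    by (auto simp: normals_def)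
  obtain a b where ab: "a \<noteq> 0" "h = {x. a \<bullet> x = b}" "P \<subseteq> {x. a \<bullet> x \<le> b}"
    using h(1) by (auto simp: support_hyperplane_def)
  have ay: "a \<bullet> y < b" using inner_less_of_interior[OF y ab(1,3)] .
  have az: "a \<bullet> z = b" using h(2) ab(2) by auto
  \<comment> \<open>\<open>t\<close> is the coefficient of the projection of \<open>z - y\<close>
    onto \<open>a\<close>; the remainder \<open>d\<close> is parallel to \<open>h\<close>, so
    orthogonality forces it to vanish.\<close>
  define t where "t = ((z - y) \<bullet> a) / (a \<bullet> a)"
  define d where "d = (z - y) - t *\<^sub>R a"
  have ad: "a \<bullet> d = 0"
    using ab(1) by (simp add: d_def t_def inner_diff_right inner_commute)
  have "z + d \<in> h" "z \<in> h" using ab(2) az ad by (auto simp: inner_add_right)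
  then have "orthogonal (z - y) ((z + d) - z)"
    using orth unfolding segment_orthogonal_def by blast
  then have "(z - y) \<bullet> d = 0" by (simp add: orthogonal_def)
  moreover have "d \<bullet> d = (z - y) \<bullet> d - t * (a \<bullet> d)"
    by (metis d_def inner_diff_left inner_scaleR_left)
  ultimately have "d \<bullet> d = 0" using ad by simp
  then have zy: "z - y = t *\<^sub>R a" by (simp add: d_def)
  have "(z - y) \<bullet> a > 0" using ay az by (simp add: inner_diff_right inner_commute)
  then have "t > 0" unfolding t_def using ab(1) by (intro divide_pos_pos) simp_all
  have "(z - y) \<bullet> (x - z) \<le> 0" if "x \<in> P" for x
  proof -
    have "a \<bullet> x - b \<le> 0" using that ab(3) by auto
    then have "t * (a \<bullet> x - b) \<le> 0" using \<open>t > 0\<close> by (simp add: mult_nonneg_nonpos)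
    moreover have "(z - y) \<bullet> (x - z) = t * (a \<bullet> x - b)"
      unfolding zy by (simp only: inner_diff_right inner_scaleR_left az right_diff_distrib)
    ultimately show ?thesis by simp
  qed
  moreover have "z \<noteq> y" using ay az by auto
  ultimately have "z \<in> bases P y" using h(2) by (auto simp: bases_def)
  then show "s \<in> closed_segment y ` bases P y" using s by auto
next
  fix s assume "s \<in> closed_segment y ` bases P y"
  then obtain z where s: "s = closed_segment y z" and z: "z \<in> P" "z \<noteq> y"
    "\<forall>x\<in>P. (z - y) \<bullet> (x - z) \<le> 0" by (auto simp: bases_def)
  define h where "h = {x. (z - y) \<bullet> x = (z - y) \<bullet> z}"
  have "support_hyperplane P h"
    unfolding support_hyperplane_def
    using z by (intro exI[of _ "z - y"] exI[of _ "(z - y) \<bullet> z"]) (auto simp: h_def inner_diff_right)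
  moreover have "segment_orthogonal y z h"
    by (auto simp: segment_orthogonal_def h_def orthogonal_def inner_diff_right)
  ultimately show "s \<in> normals P y"
    unfolding normals_def s using z(1) by (auto simp: h_def intro!: exI[of _ z] exI[of _ h])
qed

lemma num_normals_eq_card_bases:
  assumes "y \<in> interior P"
  shows "num_normals P y = card (bases P y)"
  unfolding num_normals_def normals_eq_image_bases[OF assms]
  by (rule card_image) (auto simp: inj_on_def closed_segment_eq doubleton_eq_iff)

lemma finite_support_faces: "polytope P \<Longrightarrow> finite (support_faces P)"
proof (rule finite_subset[OF _ finite_polytope_faces])
  assume P: "polytope P"
  show "support_faces P \<subseteq> {F. F face_of P}"
    using face_of_Int_supporting_hyperplane_le[OF polytope_imp_convex[OF P]]
    by (force simp: support_faces_def support_hyperplane_def)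
qed

text \<open>If two bases give the same face, each lies in the supporting hyperplane of the other;
  the two equations combine to a zero squared distance.\<close>

lemma bases_inject_support_faces:
  obtains f where "inj_on f (bases P y)" "f ` bases P y \<subseteq> support_faces P"
proof
  define f where "f z = P \<inter> {x. (z - y) \<bullet> x = (z - y) \<bullet> z}" for z
  show "inj_on f (bases P y)"
  proof (rule inj_onI)
    fix z z' assume z: "z \<in> bases P y" "z' \<in> bases P y" "f z = f z'"
    then have "z \<in> f z'" "z' \<in> f z" by (auto simp: f_def bases_def)
    then have "(z' - y) \<bullet> z = (z' - y) \<bullet> z'" "(z - y) \<bullet> z' = (z - y) \<bullet> z"
      by (auto simp: f_def)
    then have "(z - z') \<bullet> (z - z') = 0"
      by (simp add: inner_diff_left inner_diff_right inner_commute)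
    then show "z = z'" by simp
  qed
  show "f ` bases P y \<subseteq> support_faces P"
  proof (rule image_subsetI)
    fix z assume z: "z \<in> bases P y"
    have "support_hyperplane P {x. (z - y) \<bullet> x = (z - y) \<bullet> z}"
      unfolding support_hyperplane_def
      using z by (intro exI[of _ "z - y"] exI[of _ "(z - y) \<bullet> z"])
        (auto simp: bases_def inner_diff_right)
    then show "f z \<in> support_faces P" by (auto simp: f_def support_faces_def)
  qed
qed

lemma finite_card_bases:
  assumes "polytope P"
  shows "finite (bases P y)" and "card (bases P y) \<le> card (support_faces P)"
proof -
  obtain f where f: "inj_on f (bases P y)" "f ` bases P y \<subseteq> support_faces P"
    by (rule bases_inject_support_faces)
  show "finite (bases P y)"
    using f finite_support_faces[OF assms] by (metis finite_imageD finite_subset)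
  show "card (bases P y) \<le> card (support_faces P)"
    using f finite_support_faces[OF assms] by (metis card_inj_on_le)
qed

section \<open>Colourings of graphs and closed covers of an interval\<close>

text \<open>Used in place of the inequality between the numbers of vertices and edges of a connected
  graph: connectedness will appear as the statement that every such \<open>g\<close> is constant.\<close>

lemma ex_colouring_of_edges:
  fixes V :: "'i set" and E :: "('i \<times> 'i) set"
  assumes "finite V" "finite E"
  shows "\<exists>g::'i \<Rightarrow> 'i. (\<forall>(i, j)\<in>E. g i = g j) \<and> card V \<le> card (g ` V) + card E"
  using assms(2)
proof induction
  case empty
  show ?case by (rule exI[of _ id]) auto
next
  case (insert e E)
  obtain g :: "'i \<Rightarrow> 'i" where g: "\<forall>(i, j)\<in>E. g i = g j" "card V \<le> card (g ` V) + card E"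
    using insert.IH by blast
  obtain a b where e: "e = (a, b)" by (cases e)
  \<comment> \<open>The colours of the two ends of the new edge are merged, which loses at most one
    colour.\<close>
  define g' where "g' k = (if g k = g b then g a else g k)" for k
  have "g ` V \<subseteq> insert (g b) (g' ` V)" by (auto simp: g'_def)
  then have "card (g ` V) \<le> Suc (card (g' ` V))"
    using card_mono[of "insert (g b) (g' ` V)" "g ` V"] assms(1) by (simp add: card_insert_if split: if_splits)
  moreover have "\<forall>(i, j)\<in>insert e E. g' i = g' j" using g(1) by (auto simp: g'_def e)
  ultimately show ?case using g(2) insert.hyps by (intro exI[of _ g']) auto
qed

text \<open>Turns a path into a chain of overlapping sets: otherwise the sets coloured like
  \<open>i\<close> and the remaining ones would have closed unions that disconnect the
  interval.\<close>

lemma connected_finite_closed_cover_const: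
  fixes S :: "'k \<Rightarrow> real set"
  assumes fin: "finite K"
    and clo: "\<And>k. k \<in> K \<Longrightarrow> closed (S k)"
    and cov: "{0..1} \<subseteq> (\<Union>k\<in>K. S k)"
    and eq: "\<And>k l s. k \<in> K \<Longrightarrow> l \<in> K \<Longrightarrow> s \<in> {0..1} \<Longrightarrow> s \<in> S k \<Longrightarrow> s \<in> S l \<Longrightarrow> g k = g l"
    and ij: "i \<in> K" "j \<in> K" "0 \<in> S i" "1 \<in> S j"
  shows "g i = g j"
proof (rule ccontr)
  assume ne: "g i \<noteq> g j"
  let ?A = "\<Union>k\<in>{k\<in>K. g k = g i}. S k" and ?B = "\<Union>k\<in>{k\<in>K. g k \<noteq> g i}. S k"
  have "closed ?A" "closed ?B" using fin clo by (intro closed_UN; simp)+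
  moreover have "{0..1} \<subseteq> ?A \<union> ?B" using cov by auto
  moreover have "?A \<inter> ?B \<inter> {0..1} = {}"
  proof -
    have False if "s \<in> {0..1}" "k \<in> K" "g k = g i" "s \<in> S k" "l \<in> K" "g l \<noteq> g i" "s \<in> S l" for s k l
      using eq[of k l s] that by simp
    then show ?thesis by blast
  qed
  moreover have "0 \<in> ?A \<inter> {0..1}" "1 \<in> ?B \<inter> {0..1}" using ij ne by auto
  ultimately show False
    using connected_Icc[of "0::real" 1] unfolding connected_closed by (elim notE) (rule exI[of _ ?A], rule exI[of _ ?B], blast)
qed


section \<open>Halfspace descriptions and the maximal inscribed ball\<close>

text \<open>Tight constraints survive by the sign of \<open>a h \<bullet> d\<close>, slack ones by
  continuity, and there are finitely many.\<close>

lemma eventually_in_halfspaces: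
  fixes d z :: "'a::euclidean_space"
  assumes fin: "finite I" and z: "\<And>h. h \<in> I \<Longrightarrow> a h \<bullet> z \<le> b h"
    and d: "\<And>h. h \<in> I \<Longrightarrow> a h \<bullet> z = b h \<Longrightarrow> a h \<bullet> d \<le> 0"
  shows "eventually (\<lambda>e. \<forall>h\<in>I. a h \<bullet> (z + e *\<^sub>R d) \<le> b h) (at_right 0)"
proof -
  have "eventually (\<lambda>e. a h \<bullet> (z + e *\<^sub>R d) \<le> b h) (at_right 0)" if h: "h \<in> I" for h
  proof (cases "a h \<bullet> z = b h")
    case True
    have "eventually (\<lambda>e::real. e > 0) (at_right 0)" by (simp add: eventually_at_right_less)
    then show ?thesis
      by eventually_elim (use d[OF h True] True in \<open>simp add: inner_add_right mult_nonneg_nonpos\<close>)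
  next
    case False
    have "((\<lambda>e. a h \<bullet> (z + e *\<^sub>R d)) \<longlongrightarrow> a h \<bullet> (z + 0 *\<^sub>R d)) (at_right 0)"
      by (intro tendsto_intros)
    moreover have "a h \<bullet> (z + 0 *\<^sub>R d) < b h" using False z[OF h] by simp
    ultimately have "eventually (\<lambda>e. a h \<bullet> (z + e *\<^sub>R d) < b h) (at_right 0)"
      by (rule order_tendstoD)
    then show ?thesis by eventually_elim simp
  qed
  then show ?thesis using fin by (simp add: eventually_ball_finite)
qed

text \<open>With unit normals, the slack at a point of \<open>P\<close> is its distance to the
  hyperplane, so containing a ball is a linear condition on centre and radius. Redundant halfspaces
  are permitted, so a \<open>facet\<close> may be a lower-dimensional face or empty.\<close>

locale bounded_halfspaces =
  fixes I :: "('a::euclidean_space \<times> real) set" and P :: "'a set"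
  assumes fin: "finite I"
    and unit: "\<And>h. h \<in> I \<Longrightarrow> norm (fst h) = 1"
    and P_eq: "P = {x. \<forall>h\<in>I. fst h \<bullet> x \<le> snd h}"
    and bounded_P: "bounded P"
begin

definition facet :: "'a \<times> real \<Rightarrow> 'a set" where
  "facet h = P \<inter> {x. fst h \<bullet> x = snd h}"

lemma in_P_D: "x \<in> P \<Longrightarrow> h \<in> I \<Longrightarrow> fst h \<bullet> x \<le> snd h"
  by (auto simp: P_eq)

lemma in_facet_iff: "x \<in> facet h \<longleftrightarrow> x \<in> P \<and> fst h \<bullet> x = snd h"
  by (auto simp: facet_def)

lemma convex_P: "convex P" and closed_P: "closed P"
proof -
  have *: "P = (\<Inter>h\<in>I. {x. fst h \<bullet> x \<le> snd h})" by (auto simp: P_eq)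
  show "convex P" unfolding * by (intro convex_INT convex_halfspace_le)
  show "closed P" unfolding * by (intro closed_INT ballI closed_halfspace_le)
qed

lemma convex_facet: "convex (facet h)" and closed_facet: "closed (facet h)"
  unfolding facet_def
  by (intro convex_Int convex_P convex_hyperplane, intro closed_Int closed_P closed_hyperplane)

lemma I_nonempty: "I \<noteq> {}"
  using bounded_P not_bounded_UNIV unfolding P_eq by force

text \<open>The admissible pairs of centre and nonnegative radius form a compact set, on which the
  radius attains its maximum; the smallest slack at \<open>x0\<close> shows that it is
  positive.\<close>

lemma maximal_radius:
  assumes x0: "\<forall>h\<in>I. fst h \<bullet> x0 < snd h"
  obtains x r where "r > 0" "\<forall>h\<in>I. fst h \<bullet> x + r \<le> snd h"
    "\<forall>x' r'. (\<forall>h\<in>I. fst h \<bullet> x' + r' \<le> snd h) \<longrightarrow> r' \<le> r"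
proof -
  define Q where "Q = {p. 0 \<le> snd p} \<inter> (\<Inter>h\<in>I. {p :: 'a \<times> real. fst h \<bullet> fst p + snd p \<le> snd h})"
  define r0 where "r0 = Min ((\<lambda>h. snd h - fst h \<bullet> x0) ` I)"
  have r0: "r0 > 0" unfolding r0_def
    using fin I_nonempty x0 by (subst Min_gr_iff) auto
  have r0_le: "fst h \<bullet> x0 + r0 \<le> snd h" if "h \<in> I" for h
  proof -
    have "r0 \<le> snd h - fst h \<bullet> x0" unfolding r0_def using fin that by (intro Min_le) auto
    then show ?thesis by simp
  qed
  have "closed Q" unfolding Q_def
    by (intro closed_Int closed_INT ballI closed_Collect_le continuous_intros)
  moreover have "bounded Q"
  proof -
    obtain B where B: "\<And>x. x \<in> P \<Longrightarrow> norm x \<le> B" using bounded_P by (auto simp: bounded_iff)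
    obtain h where h: "h \<in> I" using I_nonempty by auto
    have "Q \<subseteq> P \<times> {0..snd h + B}"
    proof
      fix p assume p: "p \<in> Q"
      then have P: "fst p \<in> P" by (force simp: Q_def P_eq)
      have "snd p \<le> snd h - fst h \<bullet> fst p" using p h by (force simp: Q_def)
      moreover have "\<bar>fst h \<bullet> fst p\<bar> \<le> B"
        using Cauchy_Schwarz_ineq2[of "fst h" "fst p"] unit[OF h] B[OF P] by simp
      ultimately show "p \<in> P \<times> {0..snd h + B}" using P p by (auto simp: Q_def mem_Times_iff)
    qed
    then show ?thesis using bounded_subset[OF bounded_Times[OF bounded_P bounded_closed_interval]] by blast
  qed
  ultimately have "compact Q" by (simp add: compact_eq_bounded_closed)
  moreover have "(x0, r0) \<in> Q" using r0 r0_le by (auto simp: Q_def)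
  ultimately obtain p where p: "p \<in> Q" "\<And>p'. p' \<in> Q \<Longrightarrow> snd p' \<le> snd p"
    using continuous_attains_sup[of Q snd] continuous_on_snd[OF continuous_on_id] by blast
  show thesis
  proof (rule that)
    show "snd p > 0" using p(2)[OF \<open>(x0, r0) \<in> Q\<close>] r0 by simp
    show "\<forall>h\<in>I. fst h \<bullet> fst p + snd p \<le> snd h" using p(1) by (auto simp: Q_def)
    show "\<forall>x' r'. (\<forall>h\<in>I. fst h \<bullet> x' + r' \<le> snd h) \<longrightarrow> r' \<le> snd p"
    proof (intro allI impI)
      fix x' r' assume *: "\<forall>h\<in>I. fst h \<bullet> x' + r' \<le> snd h"
      show "r' \<le> snd p"
      proof (cases "r' \<ge> 0")
        case True
        then have "(x', r') \<in> Q" using * by (auto simp: Q_def)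
        then show ?thesis using p(2) by force
      next
        case False
        then show ?thesis using \<open>snd p > 0\<close> by simp
      qed
    qed
  qed
qed

text \<open>The point is an extreme point of the set of all centres of inscribed balls of maximal radius:
  extremality makes the normals of the touched hyperplanes span the whole space, and maximality
  of the radius makes them linearly dependent.\<close>

lemma centre_touching_many:
  assumes x0: "\<forall>h\<in>I. fst h \<bullet> x0 < snd h"
  obtains y r where "r > 0" "\<forall>h\<in>I. fst h \<bullet> y + r \<le> snd h"
    "card {h \<in> I. fst h \<bullet> y + r = snd h} \<ge> DIM('a) + 1"
proof -
  obtain x r where r: "r > 0" "\<forall>h\<in>I. fst h \<bullet> x + r \<le> snd h"
    "\<forall>x' r'. (\<forall>h\<in>I. fst h \<bullet> x' + r' \<le> snd h) \<longrightarrow> r' \<le> r"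
    by (rule maximal_radius[OF x0])
  define M where "M = (\<Inter>h\<in>I. {x. fst h \<bullet> x \<le> snd h - r})"
  have M_iff: "x \<in> M \<longleftrightarrow> (\<forall>h\<in>I. fst h \<bullet> x \<le> snd h - r)" for x by (auto simp: M_def)
  have "M \<subseteq> P" using r(1) by (force simp: M_iff P_eq)
  moreover have "closed M" unfolding M_def by (intro closed_INT ballI closed_halfspace_le)
  ultimately have "compact M" using bounded_P bounded_subset compact_eq_bounded_closed by blast
  moreover have "convex M" unfolding M_def by (intro convex_INT convex_halfspace_le)
  moreover have "x \<in> M" using r(2) by (auto simp: M_iff algebra_simps)
  then have "M \<noteq> {}" by auto
  ultimately obtain y where y: "y extreme_point_of M" by (rule extreme_point_exists_convex)
  then have yM: "y \<in> M" by (simp add: extreme_point_of_def)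
  define A where "A = {h \<in> I. fst h \<bullet> y + r = snd h}"
  have A: "A \<subseteq> I" "finite A" using fin by (auto simp: A_def)
  \<comment> \<open>The offset of a touched hyperplane is determined by its normal, so counting
    hyperplanes amounts to counting normals.\<close>
  have "inj_on fst A" by (auto simp: inj_on_def A_def prod_eq_iff)
  then have card_A: "card (fst ` A) = card A" by (rule card_image)
  \<comment> \<open>A direction orthogonal to all touched normals could be followed both ways inside
    \<open>M\<close>, making \<open>y\<close> a midpoint.\<close>
  have span: "span (fst ` A) = UNIV"
  proof (rule ccontr)
    assume "span (fst ` A) \<noteq> UNIV"
    then obtain d where d: "d \<noteq> 0" "\<And>u. u \<in> span (fst ` A) \<Longrightarrow> d \<bullet> u = 0"
      using span_not_UNIV_orthogonal by blast
    have Ad: "fst h \<bullet> d = 0" if "h \<in> A" for h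
      using d(2)[of "fst h"] that by (simp add: span_base inner_commute)
    have 1: "eventually (\<lambda>e. \<forall>h\<in>I. fst h \<bullet> (y + e *\<^sub>R d) \<le> snd h - r) (at_right 0)"
      by (rule eventually_in_halfspaces[OF fin]) (use yM Ad in \<open>auto simp: M_iff A_def\<close>)
    have 2: "eventually (\<lambda>e. \<forall>h\<in>I. fst h \<bullet> (y + e *\<^sub>R - d) \<le> snd h - r) (at_right 0)"
      by (rule eventually_in_halfspaces[OF fin]) (use yM Ad in \<open>auto simp: M_iff A_def\<close>)
    have "eventually (\<lambda>e. e > 0 \<and> y + e *\<^sub>R d \<in> M \<and> y - e *\<^sub>R d \<in> M) (at_right (0::real))"
      using 1 2 eventually_at_right_less[of 0] by eventually_elim (simp add: M_iff)
    then obtain e :: real where e: "e > 0" "y + e *\<^sub>R d \<in> M" "y - e *\<^sub>R d \<in> M"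
      using eventually_happens'[of "at_right (0::real)"] by force
    have "y = midpoint (y + e *\<^sub>R d) (y - e *\<^sub>R d)"
      by (simp add: midpoint_def algebra_simps flip: scaleR_2)
    moreover have "y + e *\<^sub>R d \<noteq> y - e *\<^sub>R d"
    proof
      assume "y + e *\<^sub>R d = y - e *\<^sub>R d"
      then have "(2 * e) *\<^sub>R d = 0" by (simp add: algebra_simps flip: scaleR_2)
      then show False using e(1) d(1) by simp
    qed
    ultimately have "y \<in> open_segment (y + e *\<^sub>R d) (y - e *\<^sub>R d)"
      using midpoint_in_open_segment by metis
    then show False using y e by (auto simp: extreme_point_of_def)
  qed
  have "card A > DIM('a)"
  proof (rule ccontr)
    assume "\<not> card A > DIM('a)"
    \<comment> \<open>At most \<open>DIM('a)\<close> spanning vectors are independent, so some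
      linear functional equals -1 on all of them. Moving along its representing vector
      \<open>d\<close> leaves all touched hyperplanes at unit rate, and the radius could
      grow.\<close>
    then have "independent (fst ` A)"
      using eucl.card_le_dim_spanning[of "fst ` A" UNIV] span A card_A by (simp add: dim_UNIV)
    then obtain g :: "'a \<Rightarrow> real" where g: "linear g" "\<And>u. u \<in> fst ` A \<Longrightarrow> g u = -1"
      using linear_independent_extend[of "fst ` A" "\<lambda>_. -1"] by blast
    define d where "d = adjoint g 1"
    have d: "fst h \<bullet> d = -1" if "h \<in> A" for h
      using adjoint_works[OF g(1), of "fst h" 1] g(2)[of "fst h"] that by (simp add: d_def)
    have "eventually (\<lambda>e. \<forall>h\<in>I. (fst h, 1) \<bullet> ((y, r) + e *\<^sub>R (d, 1)) \<le> snd h) (at_right 0)"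
      by (rule eventually_in_halfspaces[OF fin]) (use yM d in \<open>auto simp: M_iff A_def algebra_simps\<close>)
    then have "eventually (\<lambda>e. e > 0 \<and> (\<forall>h\<in>I. fst h \<bullet> (y + e *\<^sub>R d) + (r + e) \<le> snd h)) (at_right (0::real))"
      using eventually_at_right_less[of 0] by eventually_elim simp
    then obtain e :: real where e: "e > 0" "\<And>h. h \<in> I \<Longrightarrow> fst h \<bullet> (y + e *\<^sub>R d) + (r + e) \<le> snd h"
      using eventually_happens'[of "at_right (0::real)"] by force
    then have "r + e \<le> r" using r(3)[rule_format, of "y + e *\<^sub>R d" "r + e"] by simp
    then show False using e(1) by simp
  qed
  then show thesis
    using that[OF r(1), of y] yM by (force simp: M_iff A_def)
qed

end

section \<open>Joining facets locally below a point and radially from the farthest point\<close>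

locale pointed_polytope = bounded_halfspaces I P
  for I :: "('a::euclidean_space \<times> real) set" and P :: "'a set" +
  fixes y zs :: 'a
  assumes slack: "\<And>h. h \<in> I \<Longrightarrow> fst h \<bullet> y < snd h"
    and zs_P: "zs \<in> P"
    and farthest: "\<And>x. x \<in> P \<Longrightarrow> dist y x \<le> dist y zs"
begin

text \<open>Expansion of the squared distance: to first order, approaching \<open>y\<close> means
  positive inner product with \<open>y - z\<close>.\<close>

lemma dist_less_iff:
  "dist y (z + v) < dist y z \<longleftrightarrow> v \<bullet> v < 2 * (v \<bullet> (y - z))"
proof -
  have "dist y (z + v) < dist y z \<longleftrightarrow> (dist y (z + v))\<^sup>2 < (dist y z)\<^sup>2"
    by (metis abs_le_square_iff abs_of_nonneg linorder_not_le zero_le_dist)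
  also have "\<dots> \<longleftrightarrow> v \<bullet> v < 2 * (v \<bullet> (y - z))"
    unfolding dist_norm power2_norm_eq_inner
    by (simp add: inner_diff_left inner_diff_right inner_add_left inner_add_right inner_commute algebra_simps)
  finally show ?thesis .
qed

lemma dist_le_iff:
  "dist y (z + v) \<le> dist y z \<longleftrightarrow> v \<bullet> v \<le> 2 * (v \<bullet> (y - z))"
proof -
  have "dist y (z + v) \<le> dist y z \<longleftrightarrow> (dist y (z + v))\<^sup>2 \<le> (dist y z)\<^sup>2"
    by (metis abs_le_square_iff abs_of_nonneg zero_le_dist)
  also have "\<dots> \<longleftrightarrow> v \<bullet> v \<le> 2 * (v \<bullet> (y - z))"
    unfolding dist_norm power2_norm_eq_inner
    by (simp add: inner_diff_left inner_diff_right inner_add_left inner_add_right inner_commute algebra_simps)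
  finally show ?thesis .
qed

text \<open>The gain is linear in the step length and the loss quadratic, so a short step along a
  tangent cone direction suffices.\<close>

lemma small_step:
  assumes z: "z \<in> P" and v: "\<And>h. h \<in> I \<Longrightarrow> fst h \<bullet> z = snd h \<Longrightarrow> fst h \<bullet> v \<le> 0"
    and pos: "v \<bullet> (y - z) > 0"
  obtains e where "e > 0" "z + e *\<^sub>R v \<in> P" "dist y (z + e *\<^sub>R v) < dist y z"
proof -
  have 1: "eventually (\<lambda>e. \<forall>h\<in>I. fst h \<bullet> (z + e *\<^sub>R v) \<le> snd h) (at_right 0)"
    by (rule eventually_in_halfspaces[OF fin]) (use v in_P_D[OF z] in auto)
  have "((\<lambda>e::real. e * (v \<bullet> v)) \<longlongrightarrow> 0 * (v \<bullet> v)) (at_right 0)"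
    by (intro tendsto_intros)
  then have 2: "eventually (\<lambda>e::real. e * (v \<bullet> v) < 2 * (v \<bullet> (y - z))) (at_right 0)"
    by (rule order_tendstoD) (use pos in simp)
  have 3: "eventually (\<lambda>e::real. e > 0) (at_right 0)" by (simp add: eventually_at_right_less)
  have "eventually (\<lambda>e::real. e > 0 \<and> z + e *\<^sub>R v \<in> P \<and> dist y (z + e *\<^sub>R v) < dist y z) (at_right 0)"
    using 1 2 3
  proof eventually_elim
    case (elim e)
    have "e * (e * (v \<bullet> v)) < e * (2 * (v \<bullet> (y - z)))"
      using elim by (intro mult_strict_left_mono) auto
    then show ?case using elim unfolding dist_less_iff by (auto simp: P_eq algebra_simps)
  qed
  then have "\<exists>e. e > 0 \<and> z + e *\<^sub>R v \<in> P \<and> dist y (z + e *\<^sub>R v) < dist y z"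
    by (rule eventually_happens'[rotated]) simp
  then show thesis using that by blast
qed

text \<open>Seen modulo the direction \<open>y - z\<close>, the normals of the two hyperplanes are not opposite: some
  direction orthogonal to \<open>y - z\<close> leaves both halfspaces.\<close>

definition aligned :: "'a \<Rightarrow> 'a \<times> real \<Rightarrow> 'a \<times> real \<Rightarrow> bool" where
  "aligned z i j \<longleftrightarrow> (\<exists>w. w \<bullet> (y - z) = 0 \<and> fst i \<bullet> w > 0 \<and> fst j \<bullet> w > 0)"

text \<open>A multiple of \<open>a - z\<close> serves. The normalisation to 1 is stable under convex
  combinations and under shifts orthogonal to \<open>y - z\<close>.\<close>

lemma descending_direction:
  assumes "z \<in> facet i" "a \<in> facet i" "dist y a < dist y z"
  obtains v where "v \<bullet> (y - z) = 1" "fst i \<bullet> v = 0"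
    "\<And>h. h \<in> I \<Longrightarrow> fst h \<bullet> z = snd h \<Longrightarrow> fst h \<bullet> v \<le> 0"
proof -
  have "dist y (z + (a - z)) < dist y z" using assms by simp
  then have pos: "(a - z) \<bullet> (y - z) > 0"
    unfolding dist_less_iff using inner_ge_zero[of "a - z"] by linarith
  define v where "v = (1 / ((a - z) \<bullet> (y - z))) *\<^sub>R (a - z)"
  have "v \<bullet> (y - z) = 1" using pos by (simp add: v_def)
  moreover have "fst i \<bullet> v = 0" using assms by (simp add: v_def in_facet_iff inner_diff_right)
  moreover have "fst h \<bullet> v \<le> 0" if "h \<in> I" "fst h \<bullet> z = snd h" for h
    using that in_P_D[of a h] assms(2) pos
    by (simp add: v_def in_facet_iff inner_diff_right divide_nonpos_pos)
  ultimately show thesis using that by blast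
qed

text \<open>Two facets at \<open>z\<close> that contain points closer to \<open>y\<close> are joined by a segment in the tangent cone
  of \<open>P\<close> at \<open>z\<close>. Pushing this segment along the common outward direction \<open>w\<close> until it leaves the cone
  gives a chain of facets, consecutive ones meeting closer to \<open>y\<close> than \<open>z\<close>.\<close>

lemma local_push:
  assumes z: "z \<in> facet i" "z \<in> facet j" and ij: "i \<in> I" "j \<in> I"
    and a: "a \<in> facet i" "dist y a < dist y z" and b: "b \<in> facet j" "dist y b < dist y z"
    and al: "aligned z i j"
    and g: "\<And>k l x. k \<in> I \<Longrightarrow> l \<in> I \<Longrightarrow> x \<in> facet k \<Longrightarrow> x \<in> facet l \<Longrightarrow> dist y x < dist y z \<Longrightarrow> g k = g l"
  shows "g i = g j"
proof -
  have zP: "z \<in> P" using z by (simp add: in_facet_iff)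
  obtain va where va: "va \<bullet> (y - z) = 1" "fst i \<bullet> va = 0"
    "\<And>h. h \<in> I \<Longrightarrow> fst h \<bullet> z = snd h \<Longrightarrow> fst h \<bullet> va \<le> 0"
    using descending_direction[OF z(1) a] by blast
  obtain vb where vb: "vb \<bullet> (y - z) = 1" "fst j \<bullet> vb = 0"
    "\<And>h. h \<in> I \<Longrightarrow> fst h \<bullet> z = snd h \<Longrightarrow> fst h \<bullet> vb \<le> 0"
    using descending_direction[OF z(2) b] by blast
  obtain w where w: "w \<bullet> (y - z) = 0" "fst i \<bullet> w > 0" "fst j \<bullet> w > 0"
    using al by (auto simp: aligned_def)
  define K where "K = {k \<in> I. fst k \<bullet> z = snd k \<and> fst k \<bullet> w > 0}"
  define v where "v s = (1 - s) *\<^sub>R va + s *\<^sub>R vb" for s :: real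
  \<comment> \<open>Moving from \<open>v s\<close> along \<open>w\<close> reaches the hyperplane of
    the tangent cone belonging to \<open>k\<close> at time \<open>T k s\<close>; \<open>S k\<close>
    collects the parameters at which no other one is reached earlier.\<close>
  define T where "T k s = - (fst k \<bullet> v s) / (fst k \<bullet> w)" for k :: "'a \<times> real" and s
  define S where "S k = (\<Inter>l\<in>K. {s. T k s \<le> T l s})" for k :: "'a \<times> real"
  have finK: "finite K" using fin by (simp add: K_def)
  have iK: "i \<in> K" and jK: "j \<in> K" using ij z w by (auto simp: K_def in_facet_iff)
  have v_cone: "fst h \<bullet> v s \<le> 0" if "h \<in> I" "fst h \<bullet> z = snd h" "s \<in> {0..1}" for h s
    using va(3)[OF that(1,2)] vb(3)[OF that(1,2)] that(3)
    by (simp add: v_def inner_add_right add_nonpos_nonpos mult_nonneg_nonpos)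
  have T_nonneg: "T k s \<ge> 0" if "k \<in> K" "s \<in> {0..1}" for k s
    using v_cone[of k s] that by (simp add: T_def K_def divide_nonpos_pos)
  show ?thesis
  proof (rule connected_finite_closed_cover_const[OF finK, where S = S])
    show "closed (S k)" for k
      unfolding S_def T_def v_def divide_inverse
      by (intro closed_INT ballI closed_Collect_le continuous_intros)
    show "{0..1} \<subseteq> (\<Union>k\<in>K. S k)"
    proof
      fix s :: real assume "s \<in> {0..1}"
      obtain k where "k \<in> K" "\<forall>l\<in>K. T k s \<le> T l s"
        using ex_min_if_finite[of "(\<lambda>k. T k s) ` K"] finK iK by (force simp: not_less)
      then show "s \<in> (\<Union>k\<in>K. S k)" by (auto simp: S_def)
    qed
    show "i \<in> K" "j \<in> K" by fact+
    have "T i 0 = 0" "T j 1 = 0" using va(2) vb(2) by (simp_all add: T_def v_def)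
    then show "0 \<in> S i" "1 \<in> S j" using T_nonneg by (simp_all add: S_def)
    fix k l and s :: real assume kl: "k \<in> K" "l \<in> K" "s \<in> {0..1}" "s \<in> S k" "s \<in> S l"
    define t where "t = T k s"
    have tl: "t = T l s" using kl by (auto simp: S_def t_def intro: antisym)
    have t_min: "t \<le> T h s" if "h \<in> K" for h using kl that by (auto simp: S_def t_def)
    have t0: "t \<ge> 0" using T_nonneg kl by (simp add: t_def)
    \<comment> \<open>The exit point, common to \<open>k\<close> and \<open>l\<close>: a short step
      from \<open>z\<close> in this direction lands in both facets, closer to
      \<open>y\<close>.\<close>
    define v' where "v' = v s + t *\<^sub>R w"
    have "v s \<bullet> (y - z) = (1 - s) * (va \<bullet> (y - z)) + s * (vb \<bullet> (y - z))"
      by (simp only: v_def inner_add_left inner_scaleR_left)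
    then have "v' \<bullet> (y - z) = 1"
      using w(1) unfolding v'_def va(1) vb(1) inner_add_left inner_scaleR_left by simp
    then have pos: "v' \<bullet> (y - z) > 0" by simp
    have cone: "fst h \<bullet> v' \<le> 0" if h: "h \<in> I" "fst h \<bullet> z = snd h" for h
    proof (cases "fst h \<bullet> w > 0")
      case True
      then have "t \<le> T h s" using t_min h by (simp add: K_def)
      then have "t * (fst h \<bullet> w) \<le> - (fst h \<bullet> v s)"
        using True by (simp add: T_def pos_le_minus_divide_eq)
      then show ?thesis by (simp add: v'_def inner_add_right)
    next
      case False
      then show ?thesis using v_cone[OF h kl(3)] t0
        by (simp add: v'_def inner_add_right add_nonpos_nonpos mult_nonneg_nonpos)
    qed
    have "T h s * (fst h \<bullet> w) = - (fst h \<bullet> v s)" if "h \<in> K" for h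
      using that by (simp add: T_def K_def)
    from this[OF kl(1)] this[OF kl(2)] have kl0: "fst k \<bullet> v' = 0" "fst l \<bullet> v' = 0"
      unfolding v'_def inner_add_right inner_scaleR_right tl using tl t_def by auto
    obtain e where e: "e > 0" "z + e *\<^sub>R v' \<in> P" "dist y (z + e *\<^sub>R v') < dist y z"
      using small_step[OF zP cone pos] by blast
    show "g k = g l"
      by (rule g[OF _ _ _ _ e(3)]) (use kl kl0 e(2) in \<open>auto simp: K_def in_facet_iff inner_add_right\<close>)
  qed
qed

text \<open>\<open>P\<close> lies in the ball about \<open>y\<close> with \<open>zs\<close> on its
  boundary, and that ball meets its tangent hyperplane at \<open>zs\<close> only in
  \<open>zs\<close>.\<close>

lemma towards_from_zs:
  assumes "a \<in> P" "a \<noteq> zs"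
  shows "(a - zs) \<bullet> (y - zs) > 0"
proof -
  have "dist y (zs + (a - zs)) \<le> dist y zs" using farthest[OF assms(1)] by simp
  then have "(a - zs) \<bullet> (a - zs) \<le> 2 * ((a - zs) \<bullet> (y - zs))" by (simp only: dist_le_iff)
  moreover have "(a - zs) \<bullet> (a - zs) > 0" using assms(2) by simp
  ultimately show ?thesis by linarith
qed

text \<open>The same argument with central projection from the farthest point, which is extreme.\<close>

lemma radial_push:
  assumes ij: "i \<in> I" "j \<in> I"
    and a: "a \<in> facet i" "a \<noteq> zs" and b: "b \<in> facet j" "b \<noteq> zs"
    and g: "\<And>k l x. k \<in> I \<Longrightarrow> l \<in> I \<Longrightarrow> x \<in> facet k \<Longrightarrow> x \<in> facet l \<Longrightarrow> x \<noteq> zs \<Longrightarrow> g k = g l"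
  shows "g i = g j"
proof -
  have aP: "a \<in> P" and bP: "b \<in> P" using a b by (auto simp: in_facet_iff)
  define K where "K = {k \<in> I. fst k \<bullet> zs < snd k}"
  define v where "v s = (1 - s) *\<^sub>R (a - zs) + s *\<^sub>R (b - zs)" for s :: real
  \<comment> \<open>When positive, \<open>R k s\<close> is the reciprocal of the time at which the
    ray from \<open>zs\<close> along \<open>v s\<close> reaches the hyperplane \<open>k\<close>, so
    its maximum marks the exit from \<open>P\<close>. Reciprocals remain continuous when the ray
    becomes parallel to a hyperplane.\<close>
  define R where "R k s = (fst k \<bullet> v s) / (snd k - fst k \<bullet> zs)" for k :: "'a \<times> real" and s
  define S where "S k = (\<Inter>l\<in>K. {s. R l s \<le> R k s})" for k :: "'a \<times> real"
  have finK: "finite K" using fin by (simp add: K_def)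
  have v_nz: "v s \<noteq> 0" if "s \<in> {0..1}" for s
  proof -
    have "v s \<bullet> (y - zs) = (1 - s) * ((a - zs) \<bullet> (y - zs)) + s * ((b - zs) \<bullet> (y - zs))"
      by (simp only: v_def inner_add_left inner_scaleR_left)
    moreover have "\<dots> > 0"
      using towards_from_zs[OF aP a(2)] towards_from_zs[OF bP b(2)] that
      by (cases "s = 0") (auto intro!: add_nonneg_pos)
    ultimately show ?thesis by auto
  qed
  have v_cone: "fst h \<bullet> v s \<le> 0" if "h \<in> I" "h \<notin> K" "s \<in> {0..1}" for h s
  proof -
    have h: "fst h \<bullet> zs = snd h" using that in_P_D[OF zs_P that(1)] by (auto simp: K_def)
    then have "fst h \<bullet> (a - zs) \<le> 0" "fst h \<bullet> (b - zs) \<le> 0"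
      using in_P_D[OF aP that(1)] in_P_D[OF bP that(1)] by (auto simp: inner_diff_right)
    then show ?thesis using that(3)
      by (simp add: v_def inner_add_right add_nonpos_nonpos mult_nonneg_nonpos)
  qed
  \<comment> \<open>Otherwise the whole ray would stay in the bounded set \<open>P\<close>.\<close>
  have ex_pos: "\<exists>k\<in>K. R k s > 0" if s: "s \<in> {0..1}" for s
  proof (rule ccontr)
    assume "\<not> (\<exists>k\<in>K. R k s > 0)"
    then have neg: "fst k \<bullet> v s \<le> 0" if "k \<in> K" for k
      using that by (force simp: R_def K_def zero_less_divide_iff)
    have ray: "zs + t *\<^sub>R v s \<in> P" if "t \<ge> 0" for t
    proof -
      have "fst h \<bullet> zs + t * (fst h \<bullet> v s) \<le> snd h" if "h \<in> I" for h
      proof -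
        have "fst h \<bullet> v s \<le> 0" using v_cone[OF that _ s] neg[of h] by blast
        then have "t * (fst h \<bullet> v s) \<le> 0" using \<open>t \<ge> 0\<close> by (simp add: mult_nonneg_nonpos)
        then show ?thesis using in_P_D[OF zs_P that] by linarith
      qed
      then show ?thesis by (simp add: P_eq inner_add_right)
    qed
    obtain B where B: "\<And>x. x \<in> P \<Longrightarrow> norm x \<le> B" using bounded_P by (auto simp: bounded_iff)
    define t where "t = (B + norm zs + 1) / norm (v s)"
    have "B \<ge> 0" using B[OF zs_P] norm_ge_zero[of zs] by linarith
    then have t: "t \<ge> 0" "norm (t *\<^sub>R v s) = B + norm zs + 1"
      using v_nz[OF s] by (auto simp: t_def)
    have "norm (t *\<^sub>R v s) \<le> norm (zs + t *\<^sub>R v s) + norm zs"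
      using norm_triangle_ineq4[of "zs + t *\<^sub>R v s" zs] by simp
    then show False using B[OF ray[OF t(1)]] t(2) by simp
  qed
  have max_pos: "R k s > 0" if "k \<in> K" "s \<in> {0..1}" "s \<in> S k" for k s
    using ex_pos[OF that(2)] that(3) by (fastforce simp: S_def)
  have exit: "zs + (1 / R k s) *\<^sub>R v s \<in> facet k" if k: "k \<in> K" "s \<in> {0..1}" "s \<in> S k" for k s
  proof -
    have pos: "R k s > 0" using max_pos k .
    have le: "fst h \<bullet> zs + (1 / R k s) * (fst h \<bullet> v s) \<le> snd h" if h: "h \<in> I" for h
    proof (cases "h \<in> K")
      case True
      then have "R h s \<le> R k s" using k(3) by (auto simp: S_def)
      then have "fst h \<bullet> v s \<le> R k s * (snd h - fst h \<bullet> zs)"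
        using True by (simp add: R_def K_def pos_divide_le_eq)
      then show ?thesis using pos by (simp add: field_simps)
    next
      case False
      then have "(1 / R k s) * (fst h \<bullet> v s) \<le> 0"
        using v_cone[OF h False k(2)] pos by (simp add: divide_nonpos_pos)
      then show ?thesis using in_P_D[OF zs_P h] by linarith
    qed
    have "zs + (1 / R k s) *\<^sub>R v s \<in> P"
      unfolding P_eq using le by (simp add: inner_add_right)
    moreover have "fst k \<bullet> zs + (1 / R k s) * (fst k \<bullet> v s) = snd k"
      using k(1) pos by (auto simp: R_def K_def)
    ultimately show ?thesis by (simp add: in_facet_iff inner_add_right)
  qed
  have exit_ne: "zs + (1 / R k s) *\<^sub>R v s \<noteq> zs" if "k \<in> K" "s \<in> {0..1}" "s \<in> S k" for k s
    using max_pos[OF that] v_nz[OF that(2)] by simp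
  have cover: "\<exists>k\<in>K. s \<in> S k" if s: "s \<in> {0..1}" for s
  proof -
    have "K \<noteq> {}" using ex_pos[OF s] by auto
    then have "\<exists>k\<in>K. \<forall>l\<in>K. R l s \<le> R k s"
      using arg_min_if_finite[OF finK, of "\<lambda>k. - R k s"] by (metis neg_less_iff_less not_less)
    then show ?thesis by (auto simp: S_def)
  qed
  \<comment> \<open>If the hyperplane of \<open>m\<close> contains \<open>zs\<close>, the ray
    through \<open>c\<close> stays in it; otherwise \<open>c\<close> itself is the exit
    point.\<close>
  have start: "g m = g k"
    if m: "m \<in> I" "c \<in> facet m" and s: "s \<in> {0..1}" "v s = c - zs" and k: "k \<in> K" "s \<in> S k"
    for m c s k
  proof -
    let ?x = "zs + (1 / R k s) *\<^sub>R v s"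
    have "?x \<in> facet m"
    proof (cases "m \<in> K")
      case False
      then have "fst m \<bullet> zs = snd m" using m in_P_D[OF zs_P m(1)] by (auto simp: K_def)
      then have "fst m \<bullet> ?x = snd m" using m(2)
        by (simp add: s(2) in_facet_iff inner_add_right inner_diff_right)
      then show ?thesis using exit[OF k(1) s(1) k(2)] by (simp add: in_facet_iff)
    next
      case True
      have "R m s = 1" using m(2) True by (simp add: R_def s(2) in_facet_iff K_def inner_diff_right)
      then have "R k s \<ge> 1" using k True by (auto simp: S_def)
      moreover have "R k s \<le> 1"
        using in_P_D[of c k] m(2) k(1)
        by (simp add: R_def s(2) in_facet_iff K_def inner_diff_right)
      ultimately have "?x = c" by (simp add: s(2))
      then show ?thesis using m(2) by simp
    qed
    then show ?thesis
      using g[of m k ?x] m(1) k exit[OF k(1) s(1) k(2)] exit_ne[OF k(1) s(1) k(2)]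
      by (simp add: K_def)
  qed
  obtain i' j' where i': "i' \<in> K" "0 \<in> S i'" and j': "j' \<in> K" "1 \<in> S j'"
    using cover[of 0] cover[of 1] by auto
  have "g i' = g j'"
  proof (rule connected_finite_closed_cover_const[OF finK, where S = S])
    show "closed (S k)" for k
      unfolding S_def R_def v_def divide_inverse
      by (intro closed_INT ballI closed_Collect_le continuous_intros)
    show "{0..1} \<subseteq> (\<Union>k\<in>K. S k)" using cover by auto
    show "i' \<in> K" "j' \<in> K" "0 \<in> S i'" "1 \<in> S j'" by fact+
    fix k l and s :: real assume kl: "k \<in> K" "l \<in> K" "s \<in> {0..1}" "s \<in> S k" "s \<in> S l"
    then have "R k s = R l s" by (auto simp: S_def intro: antisym)
    then show "g k = g l"
      using g[of k l "zs + (1 / R k s) *\<^sub>R v s"] kl exit[OF kl(1,3,4)] exit[OF kl(2,3,5)]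
        exit_ne[OF kl(1,3,4)] by (simp add: K_def)
  qed
  moreover have "g i = g i'" using start[OF ij(1) a(1) _ _ i'] by (simp add: v_def)
  moreover have "g j = g j'" using start[OF ij(2) b(1) _ _ j'] by (simp add: v_def)
  ultimately show ?thesis by simp
qed

section \<open>The incidence graph of the facets and its saddles\<close>

text \<open>The vertices of the graph: a facet that is empty or reduced to \<open>zs\<close> has no
  point left once \<open>zs\<close> is removed.\<close>

definition V :: "('a \<times> real) set" where
  "V = {h \<in> I. \<exists>x\<in>facet h. x \<noteq> zs}"

definition foot :: "'a \<times> real \<Rightarrow> 'a" where
  "foot h = closest_point (facet h) y"

lemma V_subset: "V \<subseteq> I" by (auto simp: V_def)

lemma finite_V: "finite V" using fin V_subset by (rule finite_subset[rotated])

lemma foot_in_facet: "h \<in> V \<Longrightarrow> foot h \<in> facet h"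
  unfolding foot_def by (rule closest_point_exists(1)[OF closed_facet]) (auto simp: V_def)

lemma dist_foot_le: "x \<in> facet h \<Longrightarrow> dist y (foot h) \<le> dist y x"
  unfolding foot_def by (rule closest_point_le[OF closed_facet])

lemma foot_eqI:
  assumes "x \<in> facet h" "dist y x \<le> dist y (foot h)"
  shows "foot h = x"
  unfolding foot_def
proof (rule closest_point_unique[symmetric, OF convex_facet closed_facet assms(1)])
  show "\<forall>u\<in>facet h. dist y x \<le> dist y u"
    using dist_foot_le order_trans[OF assms(2)] by blast
qed

text \<open>The facets through \<open>z\<close> already present strictly below the level of
  \<open>z\<close>; any other facet of \<open>V\<close> through \<open>z\<close> is born there, with
  \<open>z\<close> as its nearest point.\<close>

definition alive :: "'a \<Rightarrow> ('a \<times> real) set" where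
  "alive z = {h \<in> V. z \<in> facet h \<and> dist y (foot h) < dist y z}"

text \<open>A chosen facet through \<open>z\<close>, to which facets born at \<open>z\<close> are
  attached. It reaches closest to \<open>y\<close>, hence is alive whenever some facet is.\<close>

definition parent :: "'a \<Rightarrow> 'a \<times> real" where
  "parent z = arg_min_on (\<lambda>h. dist y (foot h)) {h \<in> V. z \<in> facet h}"

lemma parent:
  assumes "k \<in> V" "z \<in> facet k"
  shows "parent z \<in> V" "z \<in> facet (parent z)" "dist y (foot (parent z)) \<le> dist y (foot k)"
proof -
  have "finite {h \<in> V. z \<in> facet h}" "{h \<in> V. z \<in> facet h} \<noteq> {}"
    using finite_V assms by (simp, blast)
  note m = arg_min_if_finite[OF this, of "\<lambda>h. dist y (foot h)", folded parent_def]
  show "parent z \<in> V" "z \<in> facet (parent z)" using m(1) by simp_all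
  show "dist y (foot (parent z)) \<le> dist y (foot k)"
  proof (rule ccontr)
    assume "\<not> dist y (foot (parent z)) \<le> dist y (foot k)"
    then have "\<exists>h\<in>{h \<in> V. z \<in> facet h}. dist y (foot h) < dist y (foot (parent z))"
      using assms by (intro bexI[of _ k]) simp_all
    then show False using m(2) by (rule notE[rotated])
  qed
qed

text \<open>Points where parts of the sublevel set may merge, because the local push fails for some
  pair. \<open>zs\<close> is left out since the radial push only needs incidences away from
  \<open>zs\<close>.\<close>

definition saddles :: "'a set" where
  "saddles = {z. z \<noteq> zs \<and> (\<exists>i\<in>alive z. \<exists>j\<in>alive z. \<not> aligned z i j)}"

text \<open>Modulo \<open>y - z\<close> the two normals are nonzero, and their scaled bisector
  \<open>w\<close> would witness alignment unless they point in opposite directions.\<close>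

lemma not_aligned_opposite:
  assumes "i \<in> alive z" "j \<in> alive z" "\<not> aligned z i j"
  obtains c k where "c > 0" "fst j + c *\<^sub>R fst i = k *\<^sub>R (y - z)"
proof -
  define q where "q = y - z"
  define p where "p u = u - ((u \<bullet> q) / (q \<bullet> q)) *\<^sub>R q" for u
  have zi: "z \<in> facet i" "z \<in> facet j" using assms by (auto simp: alive_def)
  have ii: "i \<in> I" "j \<in> I" using assms V_subset by (auto simp: alive_def)
  have "q \<noteq> 0" using zi(1) slack[OF ii(1)] by (auto simp: q_def in_facet_iff)
  then have pq: "p u \<bullet> q = 0" for u by (simp add: p_def inner_diff_left)
  have up: "u \<bullet> w = p u \<bullet> w" if "q \<bullet> w = 0" for u w
    using that by (simp add: p_def inner_diff_left)
  \<comment> \<open>An alive facet has a descending tangent direction; this is not orthogonal to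
    \<open>q\<close>, so the normal of the facet is no multiple of \<open>q\<close>.\<close>
  have nz: "p (fst h) \<noteq> 0" if h: "h \<in> alive z" for h
  proof
    assume "p (fst h) = 0"
    then have eq: "fst h = ((fst h \<bullet> q) / (q \<bullet> q)) *\<^sub>R q" by (simp add: p_def)
    have hI: "h \<in> I" and hf: "z \<in> facet h" "foot h \<in> facet h" "dist y (foot h) < dist y z"
      using h V_subset foot_in_facet by (auto simp: alive_def)
    obtain v where v: "v \<bullet> (y - z) = 1" "fst h \<bullet> v = 0"
      using descending_direction[OF hf] by blast
    have "fst h \<bullet> v = ((fst h \<bullet> q) / (q \<bullet> q)) * (q \<bullet> v)"
      by (subst eq) simp
    then have "(fst h \<bullet> q) / (q \<bullet> q) = 0" using v by (simp add: q_def inner_commute)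
    then have "fst h = 0" using eq by (metis scaleR_zero_left)
    then show False using unit[OF hI] by simp
  qed
  let ?a = "p (fst i)" and ?b = "p (fst j)"
  have ab: "norm ?a > 0" "norm ?b > 0" using nz assms by auto
  define w where "w = norm ?b *\<^sub>R ?a + norm ?a *\<^sub>R ?b"
  have wq: "w \<bullet> q = 0" using pq by (simp add: w_def inner_add_left)
  have 1: "fst i \<bullet> w = norm ?a * (norm ?a * norm ?b + ?a \<bullet> ?b)"
    using up[of w "fst i"] wq
    by (simp add: w_def inner_commute inner_add_right dot_square_norm power2_eq_square algebra_simps)
  have 2: "fst j \<bullet> w = norm ?b * (norm ?a * norm ?b + ?a \<bullet> ?b)"
    using up[of w "fst j"] wq
    by (simp add: w_def inner_commute inner_add_right dot_square_norm power2_eq_square algebra_simps)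
  have "norm ?a * norm ?b + ?a \<bullet> ?b \<le> 0"
  proof (rule ccontr)
    assume "\<not> norm ?a * norm ?b + ?a \<bullet> ?b \<le> 0"
    then have "fst i \<bullet> w > 0" "fst j \<bullet> w > 0" unfolding 1 2 using ab by auto
    then show False using assms(3) wq by (auto simp: aligned_def q_def)
  qed
  \<comment> \<open>The factor just shown to be nonpositive also governs the squared norm of
    \<open>w\<close>, so \<open>w\<close> vanishes: the equality case of Cauchy-Schwarz.\<close>
  moreover have "w \<bullet> w = 2 * (norm ?a * norm ?b) * (norm ?a * norm ?b + ?a \<bullet> ?b)"
  proof -
    have "w \<bullet> w = norm ?b * (?a \<bullet> w) + norm ?a * (?b \<bullet> w)"
      by (subst (1) w_def) (simp only: inner_add_left inner_scaleR_left)
    also have "\<dots> = norm ?b * (fst i \<bullet> w) + norm ?a * (fst j \<bullet> w)"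
      using up[of w "fst i"] up[of w "fst j"] wq by (simp only: inner_commute[of q w])
    finally show ?thesis unfolding 1 2 by (simp add: algebra_simps)
  qed
  ultimately have "w \<bullet> w \<le> 0" using ab by (simp add: mult_nonneg_nonpos)
  then have "w = 0" by (metis inner_gt_zero_iff not_less)
  define c where "c = norm ?b / norm ?a"
  have "?b + c *\<^sub>R ?a = (1 / norm ?a) *\<^sub>R w" using ab by (simp add: w_def c_def scaleR_add_right)
  then have "?b + c *\<^sub>R ?a = 0" using \<open>w = 0\<close> by simp
  then have eq: "fst j + c *\<^sub>R fst i = ((fst j \<bullet> q) / (q \<bullet> q) + c * ((fst i \<bullet> q) / (q \<bullet> q))) *\<^sub>R q"
    unfolding p_def by (simp add: algebra_simps)
  show thesis
  proof (rule that)
    show "c > 0" unfolding c_def using ab by (rule divide_pos_pos[rotated])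
    show "fst j + c *\<^sub>R fst i = ((fst j \<bullet> q) / (q \<bullet> q) + c * ((fst i \<bullet> q) / (q \<bullet> q))) *\<^sub>R (y - z)"
      using eq unfolding q_def .
  qed
qed

text \<open>Opposite to opposite means pointing the same way.\<close>

lemma not_aligned_trans:
  assumes "i \<in> alive z" "j \<in> alive z" "k \<in> alive z" "\<not> aligned z i j" "\<not> aligned z i k"
  shows "aligned z j k"
proof -
  obtain c r where c: "c > 0" "fst j + c *\<^sub>R fst i = r *\<^sub>R (y - z)"
    using not_aligned_opposite[OF assms(1,2,4)] .
  obtain c' r' where c': "c' > 0" "fst k + c' *\<^sub>R fst i = r' *\<^sub>R (y - z)"
    using not_aligned_opposite[OF assms(1,3,5)] .
  \<comment> \<open>Otherwise the normal of \<open>i\<close> would be a multiple of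
    \<open>y - z\<close>, against its descending tangent direction.\<close>
  have "aligned z i i"
  proof (rule ccontr)
    assume na: "\<not> aligned z i i"
    obtain d s where d: "d > 0" "fst i + d *\<^sub>R fst i = s *\<^sub>R (y - z)"
      using not_aligned_opposite[OF assms(1,1) na] .
    have i: "z \<in> facet i" "foot i \<in> facet i" "dist y (foot i) < dist y z" "i \<in> I"
      using assms(1) foot_in_facet V_subset by (auto simp: alive_def)
    obtain v where v: "v \<bullet> (y - z) = 1" "fst i \<bullet> v = 0"
      using descending_direction[OF i(1-3)] by blast
    have "(fst i + d *\<^sub>R fst i) \<bullet> v = s" unfolding d(2) using v(1) by (simp add: inner_commute)
    then have "s = 0" using v(2) by (simp add: inner_add_left)
    then have "(1 + d) *\<^sub>R fst i = 0" using d(2) by (simp add: scaleR_add_left)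
    then show False using d(1) unit[OF i(4)] by auto
  qed
  then obtain w where w: "w \<bullet> (y - z) = 0" "fst i \<bullet> w > 0" by (auto simp: aligned_def)
  have "(fst j + c *\<^sub>R fst i) \<bullet> w = 0" "(fst k + c' *\<^sub>R fst i) \<bullet> w = 0"
    unfolding c(2) c'(2) using w(1) by (simp_all add: inner_commute)
  then have "fst j \<bullet> w = - (c * (fst i \<bullet> w))" "fst k \<bullet> w = - (c' * (fst i \<bullet> w))"
    by (simp_all add: inner_add_left)
  then have "fst j \<bullet> (- w) > 0" "fst k \<bullet> (- w) > 0" using c(1) c'(1) w(2) by simp_all
  then show ?thesis using w(1) unfolding aligned_def by (intro exI[of _ "- w"]) auto
qed

text \<open>A positive combination of two outer normals at \<open>z\<close> is a multiple of
  \<open>y - z\<close>, with negative factor because \<open>y\<close> is strictly inside; so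
  \<open>z - y\<close> lies in the normal cone.\<close>

lemma saddles_subset_bases: "saddles \<subseteq> bases P y"
proof
  fix z assume "z \<in> saddles"
  then obtain i j where ij: "i \<in> alive z" "j \<in> alive z" "\<not> aligned z i j" by (auto simp: saddles_def)
  obtain c k where c: "c > 0" "fst j + c *\<^sub>R fst i = k *\<^sub>R (y - z)"
    using not_aligned_opposite[OF ij] .
  have I: "i \<in> I" "j \<in> I" and f: "z \<in> facet i" "z \<in> facet j"
    using ij V_subset by (auto simp: alive_def)
  have neg: "fst i \<bullet> (y - z) < 0" "fst j \<bullet> (y - z) < 0"
    using slack I f by (auto simp: in_facet_iff inner_diff_right)
  have "k * ((y - z) \<bullet> (y - z)) = (fst j + c *\<^sub>R fst i) \<bullet> (y - z)" by (simp add: c(2))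
  also have "\<dots> < 0" using neg c(1) by (simp add: inner_add_left add_neg_neg mult_pos_neg)
  finally have k: "k < 0" by (metis inner_ge_zero mult_less_0_iff not_less)
  have "(z - y) \<bullet> (x - z) \<le> 0" if x: "x \<in> P" for x
  proof -
    have "fst i \<bullet> (x - z) \<le> 0" "fst j \<bullet> (x - z) \<le> 0"
      using in_P_D[OF x] I f by (auto simp: in_facet_iff inner_diff_right)
    then have "(fst j + c *\<^sub>R fst i) \<bullet> (x - z) \<le> 0"
      using c(1) by (simp add: inner_add_left add_nonpos_nonpos mult_nonneg_nonpos)
    then have "k * ((y - z) \<bullet> (x - z)) \<le> 0" by (simp add: c(2))
    then have "(y - z) \<bullet> (x - z) \<ge> 0" using k by (simp add: mult_le_0_iff)
    then show ?thesis by (simp add: inner_diff_left)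
  qed
  moreover have "z \<noteq> y" using neg by auto
  ultimately show "z \<in> bases P y" using f by (auto simp: bases_def in_facet_iff)
qed

section \<open>Connectedness of the graph and the number of saddles\<close>

text \<open>A facet born at \<open>z\<close> gets its colour from \<open>g1\<close>, an alive one
  aligned with the parent from the local push. At a saddle one edge suffices, since every alive
  facet is aligned with one of its two ends.\<close>

lemma colour_near:
  assumes g1: "\<And>h. h \<in> V \<Longrightarrow> g h = g (parent (foot h))"
    and g2: "\<And>z. z \<in> saddles \<Longrightarrow> \<exists>i\<in>alive z. \<exists>j\<in>alive z. \<not> aligned z i j \<and> g i = g j"
    and near: "\<And>k l x. k \<in> I \<Longrightarrow> l \<in> I \<Longrightarrow> x \<in> facet k \<Longrightarrow> x \<in> facet l \<Longrightarrow> dist y x < dist y z \<Longrightarrow> g k = g l"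
    and z: "z \<noteq> zs" and k: "k \<in> V" "z \<in> facet k"
  shows "g k = g (parent z)"
proof (cases "k \<in> alive z")
  case False
  then have "foot k = z" using k by (intro foot_eqI) (auto simp: alive_def)
  then show ?thesis using g1[OF k(1)] by simp
next
  case True
  have push: "g i = g j" if "i \<in> alive z" "j \<in> alive z" "aligned z i j" for i j
  proof (rule local_push[of z i j "foot i" "foot j"])
    show "g k = g l"
      if "k \<in> I" "l \<in> I" "x \<in> facet k" "x \<in> facet l" "dist y x < dist y z" for k l x
      using near that .
  qed (use that V_subset foot_in_facet in \<open>auto simp: alive_def\<close>)
  have p: "parent z \<in> alive z"
    using parent[OF k] True by (auto simp: alive_def)
  show ?thesis
  proof (cases "aligned z k (parent z)")
    case al: True
    then show ?thesis using push True p by blast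
  next
    case False
    then have "z \<in> saddles" using z True p by (auto simp: saddles_def)
    then obtain i j where ij: "i \<in> alive z" "j \<in> alive z" "\<not> aligned z i j" "g i = g j"
      using g2 by blast
    have "g h = g i" if h: "h \<in> alive z" for h
    proof (cases "aligned z i h")
      case True
      then show ?thesis using push[OF ij(1) h] by simp
    next
      case False
      then have "aligned z j h" using not_aligned_trans[OF ij(1,2) h ij(3)] by simp
      then show ?thesis using push[OF ij(2) h] ij(4) by simp
    qed
    then show ?thesis using True p by metis
  qed
qed

text \<open>Levels are swept outwards from \<open>y\<close>: an incidence of two facets is treated
  at its closest point, where all closer incidences are already settled. The radial push then joins
  all of \<open>V\<close>.\<close>

lemma colour_const:
  assumes g1: "\<And>h. h \<in> V \<Longrightarrow> g h = g (parent (foot h))"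
    and g2: "\<And>z. z \<in> saddles \<Longrightarrow> \<exists>i\<in>alive z. \<exists>j\<in>alive z. \<not> aligned z i j \<and> g i = g j"
    and ij: "i \<in> V" "j \<in> V"
  shows "g i = g j"
proof -
  define c where "c k l = closest_point (facet k \<inter> facet l) y" for k l
  \<comment> \<open>Counting the incident pairs with a closer common point replaces the real-valued
    level as induction measure.\<close>
  define N where "N k l = {(k', l') \<in> V \<times> V. facet k' \<inter> facet l' \<noteq> {} \<and> dist y (c k' l') < dist y (c k l)}" for k l
  have finN: "finite (N k l)" for k l
    by (rule finite_subset[of _ "V \<times> V"]) (auto simp: N_def finite_V)
  have clo: "closed (facet k \<inter> facet l)" and con: "convex (facet k \<inter> facet l)" for k l
    by (auto intro: closed_Int closed_facet convex_Int convex_facet)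
  have c_le: "dist y (c k l) \<le> dist y x" if "x \<in> facet k \<inter> facet l" for k l x
    unfolding c_def by (rule closest_point_le[OF clo that])
  have c_in: "c k l \<in> facet k \<inter> facet l" if "facet k \<inter> facet l \<noteq> {}" for k l
    unfolding c_def by (rule closest_point_exists(1)[OF clo that])
  have *: "g k = g l" if "k \<in> V" "l \<in> V" "x \<in> facet k" "x \<in> facet l" "x \<noteq> zs" for k l x
    using that
  proof (induction "card (N k l)" arbitrary: k l x rule: less_induct)
    case less
    define z where "z = c k l"
    have ne: "facet k \<inter> facet l \<noteq> {}" using less.prems by auto
    have z: "z \<in> facet k" "z \<in> facet l" using c_in[OF ne] by (auto simp: z_def)
    have zP: "z \<in> P" using z by (simp add: in_facet_iff)
    have xP: "x \<in> P" using less.prems by (simp add: in_facet_iff)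
    \<comment> \<open>If the closest common point were farthest in \<open>P\<close>, the common
      point \<open>x\<close> would be just as close, and uniqueness would give
      \<open>x = zs\<close>.\<close>
    have "z \<noteq> zs"
    proof
      assume "z = zs"
      have "x = closest_point (facet k \<inter> facet l) y"
      proof (rule closest_point_unique[OF con clo])
        show "\<forall>u\<in>facet k \<inter> facet l. dist y x \<le> dist y u"
          using farthest[OF xP] c_le[of _ k l] unfolding \<open>z = zs\<close>[symmetric] z_def
          by (blast intro: order_trans)
      qed (use less.prems in auto)
      then show False using \<open>z = zs\<close> less.prems by (simp add: z_def c_def)
    qed
    have near: "g k' = g l'"
      if k': "k' \<in> I" "l' \<in> I" "x' \<in> facet k'" "x' \<in> facet l'" "dist y x' < dist y z" for k' l' x'
    proof -
      have "x' \<noteq> zs" using farthest[OF zP] k'(5) by auto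
      then have V': "k' \<in> V" "l' \<in> V" using k' by (auto simp: V_def)
      have less_z: "dist y (c k' l') < dist y (c k l)"
        using c_le[of x' k' l'] k' by (simp add: z_def)
      have "N k' l' \<subset> N k l"
      proof (rule psubsetI)
        show "N k' l' \<subseteq> N k l" using less_z by (auto simp: N_def)
        have "(k', l') \<in> N k l" "(k', l') \<notin> N k' l'" using V' less_z k' by (auto simp: N_def)
        then show "N k' l' \<noteq> N k l" by blast
      qed
      then have "card (N k' l') < card (N k l)" by (rule psubset_card_mono[OF finN])
      then show ?thesis using less.hyps V' k'(3,4) \<open>x' \<noteq> zs\<close> by blast
    qed
    have "g k = g (parent z)"
      by (rule colour_near[OF g1 g2 near \<open>z \<noteq> zs\<close> less.prems(1) z(1)])
    moreover have "g l = g (parent z)"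
      by (rule colour_near[OF g1 g2 near \<open>z \<noteq> zs\<close> less.prems(2) z(2)])
    ultimately show ?case by simp
  qed
  obtain a b where "a \<in> facet i" "a \<noteq> zs" "b \<in> facet j" "b \<noteq> zs" using ij by (auto simp: V_def)
  then show ?thesis
  proof (rule radial_push[rotated 2])
    show "i \<in> I" "j \<in> I" using ij V_subset by auto
    show "g k = g l" if "k \<in> I" "l \<in> I" "x \<in> facet k" "x \<in> facet l" "x \<noteq> zs" for k l x
      using *[of k l x] that by (auto simp: V_def)
  qed
qed

text \<open>The facets in \<open>A\<close> are roots. Edges from each other facet to the parent at
  its foot, and one per saddle, connect all of \<open>V\<close>, so there are at least
  \<open>card V - 1\<close> of them.\<close>

lemma card_saddles:
  assumes A: "A \<subseteq> V" "\<And>i. i \<in> A \<Longrightarrow> parent (foot i) = i" and fin_saddles: "finite saddles"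
  shows "card A \<le> card saddles + 1"
proof -
  have "\<exists>e. fst e \<in> alive z \<and> snd e \<in> alive z \<and> \<not> aligned z (fst e) (snd e)"
    if z: "z \<in> saddles" for z
  proof -
    obtain i j where "i \<in> alive z" "j \<in> alive z" "\<not> aligned z i j" using z by (auto simp: saddles_def)
    then show ?thesis by (intro exI[of _ "(i, j)"]) simp
  qed
  then obtain e where e: "fst (e z) \<in> alive z \<and> snd (e z) \<in> alive z \<and> \<not> aligned z (fst (e z)) (snd (e z))"
    if "z \<in> saddles" for z
    by metis
  define E where "E = (\<lambda>h. (h, parent (foot h))) ` (V - A) \<union> e ` saddles"
  have finE: "finite E" using finite_V fin_saddles by (simp add: E_def)
  obtain g :: "'a \<times> real \<Rightarrow> 'a \<times> real"
    where g_E: "\<forall>(i, j)\<in>E. g i = g j" and g_card: "card V \<le> card (g ` V) + card E"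
    using ex_colouring_of_edges[OF finite_V finE] by blast
  have g: "g i = g j" if "(i, j) \<in> E" for i j using g_E that by blast
  have const: "g i = g j" if "i \<in> V" "j \<in> V" for i j
  proof (rule colour_const[OF _ _ that])
    show "g h = g (parent (foot h))" if "h \<in> V" for h
      using that g[of h "parent (foot h)"] A(2)[of h] by (cases "h \<in> A") (auto simp: E_def)
    show "\<exists>i\<in>alive z. \<exists>j\<in>alive z. \<not> aligned z i j \<and> g i = g j" if "z \<in> saddles" for z
    proof -
      have "(fst (e z), snd (e z)) \<in> E" using that by (simp add: E_def)
      from g[OF this] show ?thesis using e[OF that] by blast
    qed
  qed
  have "card (g ` V) \<le> 1"
  proof (cases "V = {}")
    case False
    then obtain i where "i \<in> V" by auto
    then have "g ` V \<subseteq> {g i}" using const by blast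
    then show ?thesis using card_mono[of "{g i}" "g ` V"] by simp
  qed simp
  moreover have "card E \<le> card (V - A) + card saddles"
    unfolding E_def
    by (rule order_trans[OF card_Un_le]) (intro add_mono card_image_le finite_Diff finite_V fin_saddles)
  moreover have "card (V - A) + card A = card V"
    using A(1) finite_V by (metis card_Diff_subset card_mono finite_subset le_add_diff_inverse2)
  ultimately show ?thesis using g_card by linarith
qed

lemma zs_in_bases:
  assumes "zs \<noteq> y"
  shows "zs \<in> bases P y"
proof -
  have "(zs - y) \<bullet> (x - zs) \<le> 0" if "x \<in> P" for x
  proof (cases "x = zs")
    case False
    have "(zs - y) \<bullet> (x - zs) = - ((x - zs) \<bullet> (y - zs))"
      by (metis inner_commute inner_minus_left minus_diff_eq)
    then show ?thesis using towards_from_zs[OF that False] by simp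
  qed simp
  then show ?thesis using zs_P assms by (auto simp: bases_def)
qed

section \<open>Counting bases around an inscribed ball\<close>

context
  fixes r :: real
  assumes r_pos: "r > 0" and ball: "\<forall>h\<in>I. fst h \<bullet> y + r \<le> snd h"
begin

lemma dist_facet_ge:
  assumes "h \<in> I" "x \<in> facet h"
  shows "r \<le> dist y x"
proof -
  have "r \<le> fst h \<bullet> (x - y)" using assms ball by (auto simp: in_facet_iff inner_diff_right)
  also have "\<dots> \<le> norm (fst h) * norm (x - y)" by (rule norm_cauchy_schwarz)
  finally show ?thesis using unit[OF assms(1)] by (simp add: dist_norm norm_minus_commute)
qed

lemma cball_subset_P: "cball y r \<subseteq> P"
proof
  fix x assume x: "x \<in> cball y r"
  have "fst h \<bullet> x \<le> snd h" if h: "h \<in> I" for h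
  proof -
    have "fst h \<bullet> (x - y) \<le> norm (fst h) * norm (x - y)" by (rule norm_cauchy_schwarz)
    also have "\<dots> \<le> r" using x unit[OF h] by (simp add: dist_norm norm_minus_commute)
    finally show ?thesis using ball h by (force simp: inner_diff_right)
  qed
  then show "x \<in> P" by (simp add: P_eq)
qed

text \<open>Otherwise the polytope would be a ball, whose boundary sphere would be contained in the finite
  set of points where the ball touches the bounding hyperplanes.\<close>

lemma radius_less_dist_zs:
  assumes "DIM('a) \<ge> 2"
  shows "r < dist y zs"
proof (rule ccontr)
  assume "\<not> r < dist y zs"
  then have "P \<subseteq> cball y r" using farthest by force
  then have int: "interior P \<subseteq> ball y r" using interior_mono[of P "cball y r"] by (simp add: interior_cball)
  have sub: "sphere y r \<subseteq> (\<lambda>h. y + r *\<^sub>R fst h) ` I"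
  proof (rule subsetI, rule ccontr)
    fix x assume x: "x \<in> sphere y r" "x \<notin> (\<lambda>h. y + r *\<^sub>R fst h) ` I"
    have nx: "norm (x - y) = r" using x(1) by (simp add: dist_norm norm_minus_commute)
    have "fst h \<bullet> x < snd h" if h: "h \<in> I" for h
    proof -
      have "fst h \<bullet> (x - y) \<noteq> norm (fst h) * norm (x - y)"
      proof
        assume "fst h \<bullet> (x - y) = norm (fst h) * norm (x - y)"
        then have "x = y + r *\<^sub>R fst h"
          unfolding norm_cauchy_schwarz_eq using unit[OF h] nx by (simp add: algebra_simps)
        then show False using x(2) h by blast
      qed
      then have "fst h \<bullet> (x - y) < r"
        using norm_cauchy_schwarz[of "fst h" "x - y"] unit[OF h] nx by simp
      then show ?thesis using ball h by (force simp: inner_diff_right)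
    qed
    then have "x \<in> (\<Inter>h\<in>I. {x. fst h \<bullet> x < snd h})" by blast
    moreover have "open (\<Inter>h\<in>I. {x. fst h \<bullet> x < snd h})"
      using fin by (intro open_INT ballI open_halfspace_lt)
    moreover have "(\<Inter>h\<in>I. {x. fst h \<bullet> x < snd h}) \<subseteq> P" by (auto simp: P_eq intro: less_imp_le)
    ultimately have "x \<in> interior P" by (meson interiorI)
    then show False using int x(1) by auto
  qed
  from sub have "finite (sphere y r)" by (rule finite_subset) (rule finite_imageI[OF fin])
  moreover have "connected (sphere y r)" by (rule connected_sphere[OF assms])
  \<comment> \<open>A finite connected set has at most one point, whereas the sphere contains
    antipodal points.\<close>
  ultimately have "sphere y r = {} \<or> (\<exists>c. sphere y r = {c})"
    using connected_finite_iff_sing[of "sphere y r"] by simp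
  then have single: "u = v" if "u \<in> sphere y r" "v \<in> sphere y r" for u v
    using that by (elim disjE exE) (simp_all only: empty_iff singleton_iff)
  obtain b :: 'a where b: "b \<in> Basis" using nonempty_Basis by blast
  have "y + r *\<^sub>R b \<in> sphere y r" "y - r *\<^sub>R b \<in> sphere y r" using b r_pos by (simp_all add: dist_norm)
  then have "y + r *\<^sub>R b = y - r *\<^sub>R b" by (rule single)
  then have "(2 * r) *\<^sub>R b = 0" by (simp add: algebra_simps flip: scaleR_2)
  then show False using r_pos b nonzero_Basis by auto
qed

text \<open>Three disjoint kinds of bases are counted: k touching points at distance
  \<open>r\<close>, at least k - 1 saddles strictly farther away, and \<open>zs\<close>.\<close>

lemma card_bases_ge:
  assumes dim: "DIM('a) \<ge> 2" and fin_bases: "finite (bases P y)"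
  shows "2 * card {h \<in> I. fst h \<bullet> y + r = snd h} \<le> card (bases P y)"
proof -
  define A where "A = {h \<in> I. fst h \<bullet> y + r = snd h}"
  define t where "t h = y + r *\<^sub>R fst h" for h :: "'a \<times> real"
  note zs_far = radius_less_dist_zs[OF dim]
  have A_I: "A \<subseteq> I" by (auto simp: A_def)
  have self: "fst h \<bullet> fst h = 1" if "h \<in> I" for h
    using unit[OF that] by (simp add: dot_square_norm)
  have dist_t: "dist y (t h) = r" if "h \<in> A" for h
    using unit[of h] that A_I r_pos by (auto simp: t_def dist_norm)
  have t_facet: "t h \<in> facet h" if h: "h \<in> A" for h
  proof -
    have "t h \<in> P" using dist_t[OF h] cball_subset_P by auto
    moreover have "fst h \<bullet> t h = snd h" using h self A_I by (auto simp: t_def A_def inner_add_right)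
    ultimately show ?thesis by (simp add: in_facet_iff)
  qed
  \<comment> \<open>A hyperplane through \<open>t h\<close> that does not cut the ball has a unit
    normal with inner product at least 1 with that of \<open>h\<close>, hence the same
    normal.\<close>
  have t_only: "k = h" if h: "h \<in> A" "k \<in> I" "t h \<in> facet k" for h k
  proof -
    have hI: "h \<in> I" using h A_I by auto
    have eq: "fst k \<bullet> y + r * (fst k \<bullet> fst h) = snd k"
      using h by (simp add: t_def in_facet_iff inner_add_right)
    then have "r * 1 \<le> r * (fst k \<bullet> fst h)" using ball h(2) by force
    then have ge: "1 \<le> fst k \<bullet> fst h" using r_pos by simp
    have "(fst k - fst h) \<bullet> (fst k - fst h) = 2 - 2 * (fst k \<bullet> fst h)"
      using self[OF h(2)] self[OF hI] by (simp add: inner_diff_left inner_diff_right inner_commute)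
    then have "(fst k - fst h) \<bullet> (fst k - fst h) \<le> 0" using ge by simp
    then have f: "fst k = fst h" by (metis inner_gt_zero_iff not_less right_minus_eq)
    then have "snd k = snd h" using eq h(1) self[OF hI] by (simp add: A_def)
    then show ?thesis using f by (simp add: prod_eq_iff)
  qed
  have inj: "inj_on t A"
  proof (rule inj_onI)
    fix h k assume "h \<in> A" "k \<in> A" "t h = t k"
    then show "h = k" using t_only[of h k] t_facet[of k] A_I by auto
  qed
  have A_V: "A \<subseteq> V"
  proof
    fix h assume h: "h \<in> A"
    have "t h \<noteq> zs" using dist_t[OF h] zs_far by auto
    then show "h \<in> V" using h A_I t_facet[OF h] by (auto simp: V_def)
  qed
  have foot_A: "foot h = t h" if h: "h \<in> A" for h
  proof (rule foot_eqI[OF t_facet[OF h]])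
    show "dist y (t h) \<le> dist y (foot h)"
      using dist_facet_ge[of h "foot h"] foot_in_facet[of h] h A_V A_I dist_t[OF h] by auto
  qed
  \<comment> \<open>Being the only facet through its touching point, \<open>h\<close> is its own
    parent there, that is, a root.\<close>
  have parent_A: "parent (foot h) = h" if h: "h \<in> A" for h
  proof -
    have "parent (t h) \<in> V" "t h \<in> facet (parent (t h))"
      using parent(1,2)[of h "t h"] t_facet[OF h] h A_V by blast+
    then show ?thesis using t_only[OF h, of "parent (t h)"] V_subset by (auto simp: foot_A[OF h])
  qed
  have t_bases: "t ` A \<subseteq> bases P y"
  proof (rule image_subsetI)
    fix h assume h: "h \<in> A"
    have "(t h - y) \<bullet> (x - t h) \<le> 0" if x: "x \<in> P" for x
    proof -
      have "t h - y = r *\<^sub>R fst h" by (simp add: t_def)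
      then have "(t h - y) \<bullet> (x - t h) = r * (fst h \<bullet> x - snd h)"
        using t_facet[OF h] by (simp add: in_facet_iff inner_diff_right right_diff_distrib)
      then show ?thesis using in_P_D[OF x] h A_I r_pos by (auto simp: mult_nonneg_nonpos)
    qed
    moreover have "t h \<noteq> y" using dist_t[OF h] r_pos by auto
    ultimately show "t h \<in> bases P y" using t_facet[OF h] by (simp add: bases_def in_facet_iff)
  qed
  \<comment> \<open>The foot of an alive facet is at least \<open>r\<close> away from
    \<open>y\<close> and strictly closer than the saddle.\<close>
  have far_saddles: "r < dist y z" if "z \<in> saddles" for z
  proof -
    obtain i where "i \<in> V" "dist y (foot i) < dist y z"
      using \<open>z \<in> saddles\<close> by (auto simp: saddles_def alive_def)
    moreover from this have "r \<le> dist y (foot i)"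
      using dist_facet_ge[of i "foot i"] foot_in_facet[of i] V_subset by blast
    ultimately show ?thesis by linarith
  qed
  have fin_saddles: "finite saddles" using saddles_subset_bases fin_bases finite_subset by blast
  have fin_tA: "finite (t ` A)" using A_I fin finite_subset by blast
  have "t h \<notin> saddles" if "h \<in> A" for h
    using far_saddles[of "t h"] dist_t[OF that] by auto
  then have "t ` A \<inter> saddles = {}" by blast
  then have "card (t ` A \<union> saddles) = card A + card saddles"
    using card_Un_disjoint[OF fin_tA fin_saddles] card_image[OF inj] by simp
  moreover have "zs \<notin> t ` A \<union> saddles" using zs_far dist_t by (auto simp: saddles_def)
  ultimately have "card (insert zs (t ` A \<union> saddles)) = card A + card saddles + 1"
    using fin_tA fin_saddles by simp
  moreover have "insert zs (t ` A \<union> saddles) \<subseteq> bases P y"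
  proof -
    have "zs \<noteq> y" using zs_far r_pos by auto
    then show ?thesis using zs_in_bases t_bases saddles_subset_bases by blast
  qed
  then have "card (insert zs (t ` A \<union> saddles)) \<le> card (bases P y)"
    by (rule card_mono[OF fin_bases])
  moreover have "card A \<le> card saddles + 1" by (rule card_saddles[OF A_V parent_A fin_saddles])
  ultimately show ?thesis unfolding A_def[symmetric] by linarith
qed

end

end

section \<open>Normalised halfspaces and the two bounds\<close>

lemma polytope_bounded_halfspaces:
  fixes P :: "'a::euclidean_space set"
  assumes "polytope P"
  obtains I where "bounded_halfspaces I P"
proof -
  obtain F where F: "finite F" "P = \<Inter>F" "\<forall>h\<in>F. \<exists>a b. a \<noteq> 0 \<and> h = {x. a \<bullet> x \<le> b}"
    using polytope_imp_polyhedron[OF assms] unfolding polyhedron_def by blast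
  then obtain a b where ab: "\<And>h. h \<in> F \<Longrightarrow> a h \<noteq> 0" "\<And>h. h \<in> F \<Longrightarrow> h = {x. a h \<bullet> x \<le> b h}"
    by metis
  define I where "I = (\<lambda>h. (a h /\<^sub>R norm (a h), b h / norm (a h))) ` F"
  have *: "(a h /\<^sub>R norm (a h)) \<bullet> x \<le> b h / norm (a h) \<longleftrightarrow> x \<in> h" if h: "h \<in> F" for h x
  proof -
    have "norm (a h) > 0" using ab(1)[OF h] by simp
    then have "(a h /\<^sub>R norm (a h)) \<bullet> x \<le> b h / norm (a h) \<longleftrightarrow> a h \<bullet> x \<le> b h"
      by (simp add: field_simps)
    also have "\<dots> \<longleftrightarrow> x \<in> h" using ab(2)[OF h] by blast
    finally show ?thesis .
  qed
  have "bounded_halfspaces I P"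
  proof
    show "finite I" using F(1) by (simp add: I_def)
    show "norm (fst h) = 1" if "h \<in> I" for h using that ab(1) by (auto simp: I_def)
    show "P = {x. \<forall>h\<in>I. fst h \<bullet> x \<le> snd h}" unfolding F(2) using * by (auto simp: I_def)
    show "bounded P" using assms by (rule polytope_imp_bounded)
  qed
  then show thesis by (rule that)
qed

lemma ex_many_normals:
  fixes P :: "'a::euclidean_space set"
  assumes dim: "DIM('a) \<ge> 2" and P: "polytope P" and int: "interior P \<noteq> {}"
  shows "\<exists>y\<in>interior P. 2 * DIM('a) + 2 \<le> num_normals P y"
proof -
  obtain I where "bounded_halfspaces I P" using polytope_bounded_halfspaces[OF P] .
  then interpret bounded_halfspaces I P .
  obtain x0 where x0: "x0 \<in> interior P" using int by auto
  have "\<forall>h\<in>I. fst h \<bullet> x0 < snd h"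
  proof
    fix h assume h: "h \<in> I"
    show "fst h \<bullet> x0 < snd h"
      using x0 by (rule inner_less_of_interior) (use unit[OF h] in_P_D h in auto)
  qed
  then obtain y r where r: "r > 0" "\<forall>h\<in>I. fst h \<bullet> y + r \<le> snd h"
    and A: "card {h \<in> I. fst h \<bullet> y + r = snd h} \<ge> DIM('a) + 1"
    by (rule centre_touching_many)
  have "compact P" "P \<noteq> {}" using polytope_imp_compact[OF P] int interior_subset by auto
  then obtain zs where zs: "zs \<in> P" "\<And>x. x \<in> P \<Longrightarrow> dist y x \<le> dist y zs"
    using distance_attains_sup[of P y] by blast
  interpret pointed_polytope I P y zs
    by unfold_locales (use r zs in force)+
  have "y \<in> ball y r" using r(1) by simp
  also have "ball y r \<subseteq> interior P"
    using cball_subset_P[OF r] by (meson ball_subset_cball interior_maximal open_ball order_trans)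
  finally have y: "y \<in> interior P" .
  have "2 * (DIM('a) + 1) \<le> card (bases P y)"
    using mult_le_mono2[OF A] card_bases_ge[OF r dim finite_card_bases(1)[OF P]]
    by (rule order_trans)
  then show ?thesis by (intro bexI[OF _ y]) (simp add: num_normals_eq_card_bases[OF y])
qed

theorem theorem1:
  fixes P :: "(real ^ 'n) set"
  assumes "CARD('n) \<ge> 2"
    and "polytope P"
    and "interior P \<noteq> {}"
  shows "(\<forall>y\<in>interior P. finite (normals P y))
    \<and> finite (num_normals P ` interior P)
    \<and> finite (support_faces P)
    \<and> max_num_normals P \<ge> 2 * CARD('n) + 2
    \<and> (\<exists>y\<in>interior P. num_normals P y \<ge> 2 * CARD('n) + 2)
    \<and> max_num_normals P \<le> card (support_faces P)"
proof -
  have le: "num_normals P y \<le> card (support_faces P)" if "y \<in> interior P" for y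
    using finite_card_bases(2)[OF assms(2)] num_normals_eq_card_bases[OF that] by simp
  \<comment> \<open>A bounded set of naturals is finite, so \<open>Max\<close> is an actual
    maximum.\<close>
  then have fin: "finite (num_normals P ` interior P)"
    using finite_subset[of "num_normals P ` interior P" "{..card (support_faces P)}"] by auto
  obtain y where y: "y \<in> interior P" "num_normals P y \<ge> 2 * CARD('n) + 2"
    using ex_many_normals[of P] assms by auto
  have "max_num_normals P \<ge> num_normals P y"
    unfolding max_num_normals_def using fin y(1) by (intro Max_ge) auto
  moreover have "max_num_normals P \<le> card (support_faces P)"
    unfolding max_num_normals_def using fin y(1) le by (subst Max_le_iff) auto
  moreover have "\<forall>y\<in>interior P. finite (normals P y)"
    using normals_eq_image_bases finite_card_bases(1)[OF assms(2)] by (metis finite_imageI)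
  ultimately show ?thesis using fin y finite_support_faces[OF assms(2)] by fastforce
qed

end
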